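(* For every Pisot number $\beta\in(1,2)$, Garsia's entropy satisfies $H_\beta>0.81$.
   Context: A Pisot number is a real algebraic integer $\beta>1$ all of whose Galois conjugates other than $\beta$ itself have modulus less than $1$. For $\beta\in(1,2)$ put $I_\beta=[0,1/(\beta-1)]$ and, for $n\ge 1$, $$D_n(\beta)=\Bigl\{x\in I_\beta: x=\sum_{k=1}^n a_k\beta^{-k}\ \text{with}\ a_k\in\{0,1\}\Bigr\},$$ $$p_n(x)=\#\Bigl\{(a_1,\dots,a_n)\in\{0,1\}^n: x=\sum_{k=1}^n a_k\beta^{-k}\Bigr\}\quad (x\in D_n(\beta)),$$ $$H_\beta^{(n)}=-\sum_{x\in D_n(\beta)}\frac{p_n(x)}{2^n}\log\frac{p_n(x)}{2^n}.$$ Garsia's entropy is $H_\beta=\lim_{n\to\infty}\dfrac{H_\beta^{(n)}}{n\log\beta}$ (the limit always exists). *)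

theory Defs
  imports
    Complex_Main
    "HOL-Library.FuncSet"
    "HOL-Computational_Algebra.Computational_Algebra"
begin

definition galois_conjugate :: "complex \<Rightarrow> complex \<Rightarrow> bool" where
  "galois_conjugate x z \<longleftrightarrow>
     (\<exists>p :: rat poly. lead_coeff p = 1 \<and> irreducible p \<and>
        poly (map_poly of_rat p) x = 0 \<and> poly (map_poly of_rat p) z = 0)"

definition pisot_number :: "real \<Rightarrow> bool" where
  "pisot_number \<beta> \<longleftrightarrow> algebraic_int \<beta> \<and> \<beta> > 1 \<and>
     (\<forall>z. galois_conjugate (complex_of_real \<beta>) z \<and> z \<noteq> complex_of_real \<beta> \<longrightarrow> cmod z < 1)"

definition I_beta :: "real \<Rightarrow> real set" where
  "I_beta \<beta> = {0..1 / (\<beta> - 1)}"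

definition beta_sum :: "real \<Rightarrow> nat \<Rightarrow> (nat \<Rightarrow> nat) \<Rightarrow> real" where
  "beta_sum \<beta> n a = (\<Sum>k=1..n. real (a k) / \<beta> ^ k)"

(* The extensional function space is needed for the cardinality in digit_count: it makes each
   tuple (a_1, ..., a_n) correspond to exactly one function nat => nat. *)
definition digit_words :: "nat \<Rightarrow> (nat \<Rightarrow> nat) set" where
  "digit_words n = {1..n} \<rightarrow>\<^sub>E {0, 1}"

definition D_set :: "real \<Rightarrow> nat \<Rightarrow> real set" where
  "D_set \<beta> n = {x \<in> I_beta \<beta>. \<exists>a \<in> digit_words n. x = beta_sum \<beta> n a}"

definition digit_count :: "real \<Rightarrow> nat \<Rightarrow> real \<Rightarrow> nat" where
  "digit_count \<beta> n x = card {a \<in> digit_words n. x = beta_sum \<beta> n a}"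

definition H_level :: "real \<Rightarrow> nat \<Rightarrow> real" where
  "H_level \<beta> n =
     - (\<Sum>x\<in>D_set \<beta> n. real (digit_count \<beta> n x) / 2 ^ n * ln (real (digit_count \<beta> n x) / 2 ^ n))"

definition garsia_entropy :: "real \<Rightarrow> real" where
  "garsia_entropy \<beta> = lim (\<lambda>n. H_level \<beta> n / (real n * ln \<beta>))"

end

theory Submission
  imports Defs "HOL-Analysis.Convex"
begin

text \<open>
  The entropy of a distribution is at least minus the logarithm of its largest probability.
  It therefore suffices to bound the number of words of length \<open>n\<close> with a common sum
  by a constant times \<open>(2 * \<beta> powr (- 13 / 16)) ^ n\<close>, because then
  \<open>H_level \<beta> n\<close> is at least \<open>13 / 16 * n * ln \<beta>\<close> up to a bounded error, and
  \<open>13 / 16 = 0.8125\<close>.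

  Passing from digits \<open>0, 1\<close> to digits \<open>- 1, 1\<close>, the words with a given sum are the paths
  of the branching walk \<open>y \<mapsto> \<beta> * y - 1, \<beta> * y + 1\<close> that end in \<open>0\<close>. Such a path stays inside the
  interval \<open>\<bar>y\<bar> < 1 / (\<beta> - 1)\<close>, since a point outside never returns. If a function
  \<open>G \<ge> 0\<close> with \<open>G 0 = 1\<close> satisfies
  \<open>G (\<beta> * y - 1) + G (\<beta> * y + 1) \<le> \<rho> * G y\<close> everywhere, then at most \<open>\<rho> ^ n * G y\<close>
  paths of length \<open>n\<close> lead from \<open>y\<close> to \<open>0\<close>
  (\<open>place_count_le_supersolution\<close>). The choice made here is a power of the relative distance to
  the edge, \<open>G y = (1 - (\<beta> - 1) * \<bar>y\<bar>) powr q\<close>. While only one branch survives, this distance is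
  multiplied by at most \<open>\<beta>\<close>, which costs a factor \<open>\<beta> powr q\<close>. When both branches survive, both
  new points are close to the edge, and the inequality becomes \<open>x powr q + y powr q \<le> s powr q\<close>
  for distances \<open>x, y\<close> of which \<open>s\<close> is a fixed positive combination. Weighted
  arithmetic-geometric means decide exactly when this holds
  (\<open>powr_add_le_weighted\<close>), which leaves one numerical condition on \<open>\<beta>\<close> and \<open>q\<close>. On
  \<open>[1.5315, 2)\<close> it is met, together with \<open>\<beta> powr q \<le> 2 * \<beta> powr (- 13 / 16)\<close>, by eleven rational
  exponents on eleven intervals (\<open>exists_exponent\<close>).

  For smaller \<open>\<beta>\<close> one replaces \<open>\<beta>\<close> by a power \<open>\<gamma> = \<beta> ^ k\<close> and counts only over the places divisible
  by \<open>k\<close>: fixing the other digits costs a factor \<open>2\<close> for each of them. The powers of \<open>\<beta>\<close> meet every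
  interval \<open>[b, b\<^sup>2)\<close> with \<open>b\<^sup>2 > \<beta>\<close>, and \<open>b = 1.5315\<close> is admissible because
  \<open>b\<^sup>2 < 2 powr (16 / 13)\<close>: for \<open>\<gamma> \<ge> 2\<close> the two branches never stay in the open interval together,
  so that the count is at most \<open>1\<close>, and below that bound this is good enough.

  Garsia's entropy is defined as a limit, so its existence is part of the claim. It follows from
  subadditivity of the entropy of words under concatenation (\<open>H_level_subadditive\<close>) and
  Fekete's lemma.
\<close>

section \<open>Subadditive sequences\<close>

lemma subadditive_mult_le:
  fixes u :: "nat \<Rightarrow> real"
  assumes sub: "\<And>m n. u (m + n) \<le> u m + u n"
  shows "u (q * m + s) \<le> real q * u m + u s"
proof (induction q)
  case (Suc q)
  have "u (Suc q * m + s) = u (m + (q * m + s))" by (simp add: algebra_simps)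
  also have "\<dots> \<le> u m + u (q * m + s)" by (rule sub)
  finally show ?case using Suc by (simp add: algebra_simps)
qed simp

text \<open>
  The limit is the infimum \<open>L\<close> of the quotients. A nearly optimal \<open>m\<close> controls every large \<open>n\<close>
  through division with remainder: the whole blocks contribute at most \<open>u m / m\<close> per step, and the
  remainder contributes a constant, which disappears after division by \<open>n\<close>.
\<close>

lemma fekete_convergent:
  fixes u :: "nat \<Rightarrow> real"
  assumes sub: "\<And>m n. u (m + n) \<le> u m + u n" and nonneg: "\<And>n. 0 \<le> u n"
  shows "convergent (\<lambda>n. u n / real n)"
proof -
  define L where "L = (INF n\<in>{1..}. u n / real n)"
  have bdd: "bdd_below ((\<lambda>n. u n / real n) ` {1..})"
    using nonneg by (intro bdd_belowI2[of _ 0]) auto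
  have lower: "L \<le> u n / real n" if "n \<ge> 1" for n
    unfolding L_def by (rule cINF_lower[OF bdd]) (use that in auto)
  have "(\<lambda>n. u n / real n) \<longlonglongrightarrow> L"
  proof (rule LIMSEQ_I)
    fix e :: real assume e: "e > 0"
    have "\<exists>m\<in>{1..}. u m / real m < L + e / 2"
      unfolding L_def using e bdd by (intro cINF_less_iff[THEN iffD1]) auto
    then obtain m where m: "m \<ge> 1" "u m / real m < L + e / 2" by auto
    define C where "C = (\<Sum>s<m. u s)"
    have C: "u s \<le> C" if "s < m" for s
      unfolding C_def using that nonneg by (intro member_le_sum) auto
    have C0: "C \<ge> 0" unfolding C_def using nonneg by (intro sum_nonneg) auto
    obtain N :: nat where N: "real N > 2 * C / e" using reals_Archimedean2 by blast
    have "norm (u n / real n - L) < e" if n: "n \<ge> Suc N" for n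
    proof -
      have n0: "real n > 0" and nN: "real n > 2 * C / e" using n N by auto
      have "u n = u ((n div m) * m + n mod m)" by simp
      also have "\<dots> \<le> real (n div m) * u m + u (n mod m)" by (rule subadditive_mult_le[OF sub])
      also have "\<dots> \<le> real n / real m * u m + C"
      proof (intro add_mono mult_right_mono C nonneg)
        show "real (n div m) \<le> real n / real m" by (rule of_nat_div_le_of_nat)
        show "n mod m < m" using m(1) by simp
      qed
      finally have "u n / real n \<le> u m / real m + C / real n"
        using n0 by (simp add: field_simps)
      moreover have "C / real n < e / 2" using nN n0 e by (simp add: field_simps)
      ultimately have "u n / real n < L + e" using m(2) by linarith
      moreover have "L \<le> u n / real n" using n by (intro lower) auto
      ultimately show ?thesis by simp
    qed
    then show "\<exists>no. \<forall>n\<ge>no. norm (u n / real n - L) < e" by blast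
  qed
  then show ?thesis by (rule convergentI)
qed

section \<open>The entropy as an average over digit words\<close>

lemma finite_digit_words [simp]: "finite (digit_words n)"
  unfolding digit_words_def by (intro finite_PiE) auto

lemma card_digit_words: "card (digit_words n) = 2 ^ n"
  unfolding digit_words_def by (subst card_PiE) (auto simp: numeral_2_eq_2)

lemma beta_sum_in_I_beta:
  assumes "1 < \<beta>" and a: "a \<in> digit_words n"
  shows "beta_sum \<beta> n a \<in> I_beta \<beta>"
proof -
  have geom: "(\<Sum>k=1..n. 1 / \<beta> ^ k) = (1 - 1 / \<beta> ^ n) / (\<beta> - 1)"
  proof (induction n)
    case (Suc n)
    have "(\<Sum>k=1..Suc n. 1 / \<beta> ^ k) = (1 - 1 / \<beta> ^ n) / (\<beta> - 1) + 1 / \<beta> ^ Suc n"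
      using Suc by simp
    also have "\<dots> = (1 - 1 / \<beta> ^ Suc n) / (\<beta> - 1)"
      using assms(1) by (simp add: divide_simps) (simp add: algebra_simps)
    finally show ?case .
  qed simp
  have a01: "a k \<in> {0, 1}" if "k \<in> {1..n}" for k
    using a that unfolding digit_words_def by (auto simp: PiE_iff)
  have "beta_sum \<beta> n a \<le> (\<Sum>k=1..n. 1 / \<beta> ^ k)"
    unfolding beta_sum_def
    by (intro sum_mono divide_right_mono) (use a01 assms(1) in force)+
  also have "\<dots> \<le> 1 / (\<beta> - 1)"
    unfolding geom using assms(1) by (intro divide_right_mono) auto
  finally have "beta_sum \<beta> n a \<le> 1 / (\<beta> - 1)" .
  moreover have "0 \<le> beta_sum \<beta> n a"
    unfolding beta_sum_def using assms(1) by (intro sum_nonneg) auto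
  ultimately show ?thesis by (simp add: I_beta_def)
qed

text \<open>
  Grouping the words by their sums turns the sum over \<open>D_set \<beta> n\<close> into an average over all words.
  In this form neither the lower bound nor subadditivity needs any convexity argument: both reduce
  to inequalities between single logarithms.
\<close>

lemma H_level_eq_average:
  assumes "1 < \<beta>"
  shows "H_level \<beta> n =
    - (\<Sum>a\<in>digit_words n. ln (real (digit_count \<beta> n (beta_sum \<beta> n a)) / 2 ^ n)) / 2 ^ n"
proof -
  let ?S = "beta_sum \<beta> n" and ?W = "digit_words n"
  let ?g = "\<lambda>x. ln (real (digit_count \<beta> n x) / 2 ^ n)"
  have D: "D_set \<beta> n = ?S ` ?W"
    unfolding D_set_def using beta_sum_in_I_beta[OF assms] by auto
  have "(\<Sum>a\<in>?W. ?g (?S a)) = (\<Sum>x\<in>?S ` ?W. \<Sum>a\<in>{a\<in>?W. ?S a = x}. ?g (?S a))"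
    by (rule sum.image_gen) simp
  also have "\<dots> = (\<Sum>x\<in>?S ` ?W. real (digit_count \<beta> n x) * ?g x)"
  proof (rule sum.cong[OF refl])
    fix x
    have "(\<Sum>a\<in>{a\<in>?W. ?S a = x}. ?g (?S a)) = (\<Sum>a\<in>{a\<in>?W. ?S a = x}. ?g x)"
      by (rule sum.cong) auto
    also have "\<dots> = real (digit_count \<beta> n x) * ?g x"
      by (simp add: digit_count_def eq_commute[of x])
    finally show "(\<Sum>a\<in>{a\<in>?W. ?S a = x}. ?g (?S a)) = real (digit_count \<beta> n x) * ?g x" .
  qed
  finally show ?thesis
    unfolding H_level_def D by (simp add: sum_divide_distrib)
qed

lemma digit_count_pos:
  assumes "a \<in> digit_words n"
  shows "0 < digit_count \<beta> n (beta_sum \<beta> n a)"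
  unfolding digit_count_def using assms by (subst card_gt_0_iff) auto

lemma digit_count_le: "digit_count \<beta> n x \<le> 2 ^ n"
  unfolding digit_count_def card_digit_words[symmetric] by (intro card_mono) auto

lemma H_level_ge:
  assumes "1 < \<beta>" and bound: "\<And>x. real (digit_count \<beta> n x) / 2 ^ n \<le> exp (- h)"
  shows "h \<le> H_level \<beta> n"
proof -
  have "(\<Sum>a\<in>digit_words n. ln (real (digit_count \<beta> n (beta_sum \<beta> n a)) / 2 ^ n))
      \<le> (\<Sum>a\<in>digit_words n. - h)"
  proof (rule sum_mono)
    fix a assume "a \<in> digit_words n"
    then have "0 < real (digit_count \<beta> n (beta_sum \<beta> n a)) / 2 ^ n"
      by (simp add: digit_count_pos)
    then show "ln (real (digit_count \<beta> n (beta_sum \<beta> n a)) / 2 ^ n) \<le> - h"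
      using bound[of "beta_sum \<beta> n a"] by (metis ln_exp ln_le_cancel_iff exp_gt_zero)
  qed
  then show ?thesis
    unfolding H_level_eq_average[OF assms(1)] by (simp add: card_digit_words field_simps)
qed

lemma H_level_nonneg:
  assumes "1 < \<beta>"
  shows "0 \<le> H_level \<beta> n"
proof (rule H_level_ge[OF assms])
  fix x
  have "real (digit_count \<beta> n x) \<le> 2 ^ n"
    using digit_count_le[of \<beta> n x] by (metis of_nat_le_iff of_nat_numeral of_nat_power)
  then show "real (digit_count \<beta> n x) / 2 ^ n \<le> exp (- 0)" by simp
qed

definition concat_words :: "nat \<Rightarrow> nat \<Rightarrow> (nat \<Rightarrow> nat) \<Rightarrow> (nat \<Rightarrow> nat) \<Rightarrow> nat \<Rightarrow> nat" where
  "concat_words n m a b =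
     (\<lambda>k\<in>{1..n + m}. if k \<le> n then a k else b (k - n))"

lemma digit_words_D:
  assumes "a \<in> digit_words n"
  shows "k \<in> {1..n} \<Longrightarrow> a k \<in> {0, 1}" "k \<notin> {1..n} \<Longrightarrow> a k = undefined"
proof -
  have a: "a \<in> {1..n} \<rightarrow>\<^sub>E {0, 1}" using assms by (simp add: digit_words_def)
  show "k \<in> {1..n} \<Longrightarrow> a k \<in> {0, 1}" by (rule PiE_mem[OF a])
  show "k \<notin> {1..n} \<Longrightarrow> a k = undefined" by (rule PiE_arb[OF a])
qed

lemma concat_words_in_digit_words:
  assumes "a \<in> digit_words n" "b \<in> digit_words m"
  shows "concat_words n m a b \<in> digit_words (n + m)"
proof -
  have "(if k \<le> n then a k else b (k - n)) \<in> {0, 1}" if "k \<in> {1..n + m}" for k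
  proof (cases "k \<le> n")
    case True
    then show ?thesis using digit_words_D(1)[OF assms(1), of k] that by simp
  next
    case False
    then have "k - n \<in> {1..m}" using that by auto
    then show ?thesis using digit_words_D(1)[OF assms(2), of "k - n"] False by simp
  qed
  then show ?thesis unfolding concat_words_def digit_words_def restrict_PiE_iff by (rule ballI)
qed

lemma bij_betw_concat_words:
  "bij_betw (\<lambda>(a, b). concat_words n m a b) (digit_words n \<times> digit_words m) (digit_words (n + m))"
    (is "bij_betw ?cat _ _")
proof (rule bij_betw_byWitness)
  define split where
    "split c = (restrict c {1..n}, restrict (\<lambda>k. c (k + n)) {1..m})" for c :: "nat \<Rightarrow> nat"
  show "\<forall>w\<in>digit_words n \<times> digit_words m. split (?cat w) = w"
  proof
    fix w assume "w \<in> digit_words n \<times> digit_words m"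
    then obtain a b where w: "w = (a, b)" and ab: "a \<in> digit_words n" "b \<in> digit_words m"
      by (rule SigmaE)
    have "restrict (concat_words n m a b) {1..n} = a"
    proof
      fix k show "restrict (concat_words n m a b) {1..n} k = a k"
        using digit_words_D(2)[OF ab(1), of k]
        by (cases "k \<in> {1..n}") (simp_all add: concat_words_def)
    qed
    moreover have "restrict (\<lambda>k. concat_words n m a b (k + n)) {1..m} = b"
    proof
      fix k show "restrict (\<lambda>k. concat_words n m a b (k + n)) {1..m} k = b k"
        using digit_words_D(2)[OF ab(2), of k]
        by (cases "k \<in> {1..m}") (simp_all add: concat_words_def)
    qed
    ultimately show "split (?cat w) = w"
      unfolding w split_def prod.case by (rule arg_cong2)
  qed
  show "\<forall>c\<in>digit_words (n + m). ?cat (split c) = c"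
  proof
    fix c assume c: "c \<in> digit_words (n + m)"
    show "?cat (split c) = c"
      unfolding split_def prod.case
    proof
      fix k
      consider "k \<in> {1..n}" | "k \<notin> {1..n}" "k \<in> {1..n + m}" | "k \<notin> {1..n + m}" by blast
      then show "concat_words n m (restrict c {1..n}) (restrict (\<lambda>k. c (k + n)) {1..m}) k = c k"
      proof cases
        case 1
        then show ?thesis by (simp add: concat_words_def)
      next
        case 2
        then have "\<not> k \<le> n" "Suc 0 \<le> k - n" "k - n \<le> m" "k - n + n = k" by auto
        then show ?thesis using 2(2) by (simp add: concat_words_def)
      next
        case 3
        then have "concat_words n m a b k = undefined" for a b
          unfolding concat_words_def restrict_apply by (rule if_not_P)
        then show ?thesis using digit_words_D(2)[OF c 3] by simp
      qed
    qed
  qed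
  show "?cat ` (digit_words n \<times> digit_words m) \<subseteq> digit_words (n + m)"
    by (rule image_subsetI, elim SigmaE) (simp add: concat_words_in_digit_words)
  show "split ` digit_words (n + m) \<subseteq> digit_words n \<times> digit_words m"
  proof (rule image_subsetI)
    fix c assume c: "c \<in> digit_words (n + m)"
    have "restrict c {1..n} \<in> digit_words n" "restrict (\<lambda>k. c (k + n)) {1..m} \<in> digit_words m"
      unfolding digit_words_def restrict_PiE_iff using digit_words_D(1)[OF c] by simp_all
    then show "split c \<in> digit_words n \<times> digit_words m" unfolding split_def by (rule SigmaI)
  qed
qed

lemma beta_sum_concat_words:
  "beta_sum \<beta> (n + m) (concat_words n m a b) = beta_sum \<beta> n a + beta_sum \<beta> m b / \<beta> ^ n"
proof -
  let ?c = "concat_words n m a b"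
  have left: "?c k = a k" if "k \<in> {1..n}" for k
    using that by (simp add: concat_words_def)
  have right: "?c (k + n) = b k" if "k \<in> {1..m}" for k
    using that by (simp add: concat_words_def)
  have "beta_sum \<beta> (n + m) ?c
      = (\<Sum>k=1..n. real (?c k) / \<beta> ^ k) + (\<Sum>k=n+1..n+m. real (?c k) / \<beta> ^ k)"
    unfolding beta_sum_def by (rule sum.ub_add_nat) simp
  moreover have "(\<Sum>k=1..n. real (?c k) / \<beta> ^ k) = beta_sum \<beta> n a"
    unfolding beta_sum_def by (rule sum.cong[OF refl]) (simp only: left)
  moreover have "(\<Sum>k=n+1..n+m. real (?c k) / \<beta> ^ k) = beta_sum \<beta> m b / \<beta> ^ n"
  proof -
    have "(\<Sum>k=n+1..n+m. real (?c k) / \<beta> ^ k) = (\<Sum>k=1+n..m+n. real (?c k) / \<beta> ^ k)"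
      by (simp only: add.commute)
    also have "\<dots> = (\<Sum>k=1..m. real (?c (k + n)) / \<beta> ^ (k + n))"
      by (rule sum.shift_bounds_cl_nat_ivl)
    also have "\<dots> = (\<Sum>k=1..m. real (b k) / \<beta> ^ k / \<beta> ^ n)"
      by (rule sum.cong[OF refl]) (simp only: right power_add divide_divide_eq_left)
    finally show ?thesis unfolding beta_sum_def sum_divide_distrib .
  qed
  ultimately show ?thesis by (simp only:)
qed

text \<open>
  Concatenating a word with sum \<open>x\<close> and a word with sum \<open>y\<close> yields distinct words with the common sum
  \<open>x + y / \<beta> ^ n\<close>. This is the supermultiplicativity of probabilities behind the subadditivity of
  the entropy.
\<close>

lemma digit_count_mult_le:
  "digit_count \<beta> n x * digit_count \<beta> m y \<le> digit_count \<beta> (n + m) (x + y / \<beta> ^ n)"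
proof -
  let ?A = "{a \<in> digit_words n. x = beta_sum \<beta> n a}"
  let ?B = "{b \<in> digit_words m. y = beta_sum \<beta> m b}"
  have "card (?A \<times> ?B) \<le> card {c \<in> digit_words (n + m). x + y / \<beta> ^ n = beta_sum \<beta> (n + m) c}"
  proof (rule card_inj_on_le)
    show "inj_on (\<lambda>(a, b). concat_words n m a b) (?A \<times> ?B)"
      by (rule inj_on_subset[OF bij_betw_imp_inj_on[OF bij_betw_concat_words]]) auto
    show "(\<lambda>(a, b). concat_words n m a b) ` (?A \<times> ?B)
        \<subseteq> {c \<in> digit_words (n + m). x + y / \<beta> ^ n = beta_sum \<beta> (n + m) c}"
    proof (rule image_subsetI, clarify)
      fix a b assume "a \<in> digit_words n" "b \<in> digit_words m"
      then show "concat_words n m a b \<in> digit_words (n + m) \<and>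
          beta_sum \<beta> n a + beta_sum \<beta> m b / \<beta> ^ n = beta_sum \<beta> (n + m) (concat_words n m a b)"
        using bij_betw_apply[OF bij_betw_concat_words, of "(a, b)"] by (simp add: beta_sum_concat_words)
    qed
  qed simp
  then show ?thesis by (simp add: digit_count_def card_cartesian_product)
qed

lemma H_level_subadditive:
  assumes "1 < \<beta>"
  shows "H_level \<beta> (n + m) \<le> H_level \<beta> n + H_level \<beta> m"
proof -
  define l where "l n a = ln (real (digit_count \<beta> n (beta_sum \<beta> n a)) / 2 ^ n)" for n a
  define L where "L n = (\<Sum>a\<in>digit_words n. l n a)" for n
  have H: "H_level \<beta> n = - L n / 2 ^ n" for n
    unfolding H_level_eq_average[OF assms] L_def l_def ..
  have "(\<Sum>(a, b)\<in>digit_words n \<times> digit_words m. l n a + l m b)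
      = (\<Sum>a\<in>digit_words n. \<Sum>b\<in>digit_words m. l n a + l m b)"
    by (rule sum.cartesian_product[symmetric])
  also have "\<dots> = 2 ^ m * L n + 2 ^ n * L m"
    unfolding L_def by (simp add: sum.distrib card_digit_words sum_distrib_left)
  finally have "2 ^ m * L n + 2 ^ n * L m
      = (\<Sum>(a, b)\<in>digit_words n \<times> digit_words m. l n a + l m b)" ..
  also have "\<dots> \<le> (\<Sum>(a, b)\<in>digit_words n \<times> digit_words m. l (n + m) (concat_words n m a b))"
  proof (rule sum_mono, clarify)
    fix a b assume ab: "a \<in> digit_words n" "b \<in> digit_words m"
    define p where "p = real (digit_count \<beta> n (beta_sum \<beta> n a))"
    define q where "q = real (digit_count \<beta> m (beta_sum \<beta> m b))"
    define t where "t = real (digit_count \<beta> (n + m) (beta_sum \<beta> (n + m) (concat_words n m a b)))"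
    have pos: "0 < p" "0 < q" using ab by (simp_all add: digit_count_pos p_def q_def)
    have le: "p * q \<le> t"
      unfolding p_def q_def t_def beta_sum_concat_words of_nat_mult[symmetric] of_nat_le_iff
      by (rule digit_count_mult_le)
    have "ln (p / 2 ^ n) + ln (q / 2 ^ m) = ln ((p / 2 ^ n) * (q / 2 ^ m))"
      using pos by (intro ln_mult_pos[symmetric]) auto
    also have "(p / 2 ^ n) * (q / 2 ^ m) = p * q / 2 ^ (n + m)" by (simp add: power_add)
    also have "ln (p * q / 2 ^ (n + m)) \<le> ln (t / 2 ^ (n + m))"
      using le mult_pos_pos[OF pos] by (intro ln_mono divide_right_mono) auto
    finally show "l n a + l m b \<le> l (n + m) (concat_words n m a b)"
      unfolding l_def p_def q_def t_def .
  qed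
  also have "\<dots> = L (n + m)"
    using sum.reindex_bij_betw[OF bij_betw_concat_words, of "l (n + m)" n m]
    unfolding L_def by (simp add: case_prod_unfold)
  finally have "- L (n + m) / 2 ^ (n + m) \<le> - (2 ^ m * L n + 2 ^ n * L m) / 2 ^ (n + m)"
    by (intro divide_right_mono) auto
  also have "\<dots> = - L n / 2 ^ n + - L m / 2 ^ m"
    by (simp add: power_add field_simps)
  finally show ?thesis unfolding H .
qed

lemma H_level_rate_convergent:
  assumes "1 < \<beta>"
  shows "convergent (\<lambda>n. H_level \<beta> n / (real n * ln \<beta>))"
proof -
  have "convergent (\<lambda>n. H_level \<beta> n / real n)"
    by (rule fekete_convergent) (simp_all add: assms H_level_subadditive H_level_nonneg)
  then have "convergent (\<lambda>n. H_level \<beta> n / real n * (1 / ln \<beta>))"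
    by (intro convergent_mult convergent_const)
  then show ?thesis by simp
qed

section \<open>Counting representations over a set of places\<close>

text \<open>
  The places that carry a digit form an arbitrary set instead of \<open>{1..n}\<close>, so that digits can be
  split off at any place. Both the first place and the places not divisible by some \<open>k\<close> are
  removed in this way below.
\<close>

definition place_count :: "real \<Rightarrow> nat set \<Rightarrow> real \<Rightarrow> nat" where
  "place_count \<beta> A x = card {a \<in> A \<rightarrow>\<^sub>E {0, 1::nat}. (\<Sum>k\<in>A. real (a k) / \<beta> ^ k) = x}"

lemma digit_count_eq_place_count: "digit_count \<beta> n x = place_count \<beta> {1..n} x"
  unfolding digit_count_def place_count_def digit_words_def beta_sum_def
  by (rule arg_cong[where f = card], rule Collect_cong, rule conj_cong[OF refl eq_commute])

lemma place_count_empty: "place_count \<beta> {} x = (if x = 0 then 1 else 0)"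
  unfolding place_count_def by (auto simp: card_eq_0_iff)

lemma place_count_insert:
  assumes A: "finite A" "i \<notin> A"
  shows "place_count \<beta> (insert i A) x = place_count \<beta> A x + place_count \<beta> A (x - 1 / \<beta> ^ i)"
proof -
  let ?S = "\<lambda>A a. \<Sum>k\<in>A. real (a k) / \<beta> ^ k"
  let ?W = "A \<rightarrow>\<^sub>E {0, 1::nat}"
  define F where "F y = {a \<in> ?W. ?S A a = y}" for y
  have F: "place_count \<beta> A y = card (F y)" "finite (F y)" for y
    unfolding F_def place_count_def using A(1) by (simp_all add: finite_PiE)
  have upd: "?S (insert i A) (a(i := d)) = real d / \<beta> ^ i + ?S A a" for a d
  proof -
    have "?S A (a(i := d)) = ?S A a" using A(2) by (intro sum.cong) auto
    then show ?thesis using A by simp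
  qed
  have "insert i A \<rightarrow>\<^sub>E {0, 1::nat} = (\<lambda>a. a(i := 0)) ` ?W \<union> (\<lambda>a. a(i := 1)) ` ?W"
  proof -
    have "(\<lambda>(d, a). a(i := d)) ` ({0, 1::nat} \<times> W) = (\<lambda>a. a(i := 0)) ` W \<union> (\<lambda>a. a(i := 1)) ` W"
      for W :: "(nat \<Rightarrow> nat) set"
      by force
    then show ?thesis unfolding PiE_insert_eq .
  qed
  then have union: "{a \<in> insert i A \<rightarrow>\<^sub>E {0, 1::nat}. ?S (insert i A) a = x}
      = {a \<in> (\<lambda>a. a(i := 0)) ` ?W. ?S (insert i A) a = x}
        \<union> {a \<in> (\<lambda>a. a(i := 1)) ` ?W. ?S (insert i A) a = x}"
    by (simp only: Un_iff conj_disj_distribR Collect_disj_eq)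
  have "{a \<in> (\<lambda>a. a(i := d)) ` ?W. ?S (insert i A) a = x}
      = (\<lambda>a. a(i := d)) ` F (x - real d / \<beta> ^ i)" for d
  proof -
    have "{a \<in> (\<lambda>a. a(i := d)) ` ?W. ?S (insert i A) a = x}
        = (\<lambda>a. a(i := d)) ` {a \<in> ?W. ?S (insert i A) (a(i := d)) = x}"
      by (rule Compr_image_eq)
    also have "{a \<in> ?W. ?S (insert i A) (a(i := d)) = x} = F (x - real d / \<beta> ^ i)"
      unfolding upd F_def by (rule Collect_cong) (simp add: eq_diff_eq add.commute)
    finally show ?thesis .
  qed
  from this[of 0] this[of 1]
  have "{a \<in> (\<lambda>a. a(i := 0)) ` ?W. ?S (insert i A) a = x} = (\<lambda>a. a(i := 0)) ` F x"
    "{a \<in> (\<lambda>a. a(i := 1)) ` ?W. ?S (insert i A) a = x} = (\<lambda>a. a(i := 1)) ` F (x - 1 / \<beta> ^ i)"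
    by (simp_all only: of_nat_0 of_nat_1 div_0 diff_zero)
  note parts = this
  have split: "{a \<in> insert i A \<rightarrow>\<^sub>E {0, 1::nat}. ?S (insert i A) a = x}
      = (\<lambda>a. a(i := 0)) ` F x \<union> (\<lambda>a. a(i := 1)) ` F (x - 1 / \<beta> ^ i)"
    by (rule trans[OF union arg_cong2[OF parts, where f = "(\<union>)"]])
  have card: "card ((\<lambda>a. a(i := d)) ` F y) = card (F y)" for d y
  proof (rule card_image, rule inj_onI)
    fix a b assume ab: "a \<in> F y" "b \<in> F y" "a(i := d) = b(i := d)"
    have W: "a \<in> ?W" "b \<in> ?W" using ab(1,2) unfolding F_def by (simp_all only: mem_Collect_eq)
    have "a i = b i" using PiE_arb[OF W(1) A(2)] PiE_arb[OF W(2) A(2)] by (rule trans[OF _ sym])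
    then have "(a(i := d))(i := a i) = (b(i := d))(i := b i)" unfolding ab(3) by simp
    then show "a = b" by simp
  qed
  have disjoint: "(\<lambda>a. a(i := 0)) ` F x \<inter> (\<lambda>a. a(i := 1)) ` F (x - 1 / \<beta> ^ i) = {}"
  proof (rule equals0I, elim IntE imageE)
    fix c a b :: "nat \<Rightarrow> nat" assume c: "c = a(i := 0)" "c = b(i := 1)"
    have "c i = 0" unfolding c(1) by simp
    moreover have "c i = 1" unfolding c(2) by simp
    ultimately show False by simp
  qed
  have "place_count \<beta> (insert i A) x
      = card ((\<lambda>a. a(i := 0)) ` F x) + card ((\<lambda>a. a(i := 1)) ` F (x - 1 / \<beta> ^ i))"
    unfolding place_count_def split by (intro card_Un_disjoint finite_imageI F(2) disjoint)
  then show ?thesis unfolding F(1) card .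
qed

text \<open>
  Each digit outside \<open>A\<close> can only double the largest multiplicity.
\<close>

lemma place_count_Un_le:
  assumes "finite C" "finite A" "A \<inter> C = {}" and bound: "\<And>x. real (place_count \<beta> A x) \<le> K"
  shows "real (place_count \<beta> (A \<union> C) x) \<le> 2 ^ card C * K"
  using assms(1,3)
proof (induction C arbitrary: x)
  case empty
  then show ?case using bound by simp
next
  case (insert i C)
  have "real (place_count \<beta> (A \<union> insert i C) x)
      = real (place_count \<beta> (A \<union> C) x) + real (place_count \<beta> (A \<union> C) (x - 1 / \<beta> ^ i))"
    using insert assms(2) by (subst Un_insert_right, subst place_count_insert) auto
  also have "\<dots> \<le> 2 ^ card C * K + 2 ^ card C * K"
    using insert by (intro add_mono) auto
  also have "\<dots> = 2 ^ card (insert i C) * K" using insert.hyps by simp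
  finally show ?case .
qed

text \<open>
  Reading the digit at the first place \<open>k * (j + 1)\<close> moves the walk one step. Let \<open>y\<close> be the
  argument of \<open>G\<close>, that is, the remainder for digits \<open>- 1, 1\<close> rescaled so that its next digit has
  weight \<open>1 / \<beta> ^ k\<close>. Digit \<open>0\<close> leads to \<open>\<beta> ^ k * y + 1\<close> and digit \<open>1\<close> to \<open>\<beta> ^ k * y - 1\<close>, and
  the only path without digits is the one that is already at \<open>0\<close>.
\<close>

lemma place_count_le_supersolution:
  fixes G :: "real \<Rightarrow> real"
  assumes G0: "G 0 = 1" and nonneg: "\<And>y. 0 \<le> G y" and "\<rho> \<ge> 0" and "\<beta> > 0" "k > 0"
    and super: "\<And>y. G (\<beta> ^ k * y - 1) + G (\<beta> ^ k * y + 1) \<le> \<rho> * G y"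
  shows "real (place_count \<beta> ((*) k ` {j+1..j+m}) x)
    \<le> \<rho> ^ m * G ((\<beta> ^ k) ^ j * (2 * x - (\<Sum>i=j+1..j+m. 1 / (\<beta> ^ k) ^ i)))"
proof (induction m arbitrary: j x)
  case 0
  then show ?case using G0 nonneg by (simp add: place_count_empty)
next
  case (Suc m)
  define \<gamma> where "\<gamma> = \<beta> ^ k"
  have \<gamma>: "\<gamma> > 0" unfolding \<gamma>_def using assms by simp
  define A where "A = (*) k ` {Suc j+1..Suc j+m}"
  define s where "s = (\<Sum>i=Suc j+1..Suc j+m. 1 / \<gamma> ^ i)"
  define t where "t = 1 / \<gamma> ^ Suc j"
  define y where "y = \<gamma> ^ j * (2 * x - (t + s))"
  have range: "{j+1..j+Suc m} = insert (Suc j) {Suc j+1..Suc j+m}" by auto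
  have "inj ((*) k)" using assms(5) by (simp add: inj_on_def)
  then have notin: "k * Suc j \<notin> A" unfolding A_def by (subst inj_image_mem_iff) auto
  have IH: "real (place_count \<beta> A x) \<le> \<rho> ^ m * G (\<gamma> ^ Suc j * (2 * x - s))" for x
    using Suc[where j = "Suc j"] unfolding A_def s_def \<gamma>_def .
  have unit: "\<gamma> * \<gamma> ^ j * t = 1" unfolding t_def using \<gamma> by simp
  have e1: "\<gamma> ^ Suc j * (2 * x - s) = \<gamma> * y + 1"
    unfolding y_def using unit by (simp add: algebra_simps)
  have e2: "\<gamma> ^ Suc j * (2 * (x - t) - s) = \<gamma> * y - 1"
    unfolding y_def using unit by (simp add: algebra_simps)
  have "(*) k ` {j+1..j+Suc m} = insert (k * Suc j) A" unfolding range A_def by simp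
  moreover have "1 / \<beta> ^ (k * Suc j) = t" unfolding t_def \<gamma>_def by (simp only: power_mult)
  moreover have "finite A" unfolding A_def by simp
  ultimately have "real (place_count \<beta> ((*) k ` {j+1..j+Suc m}) x)
      = real (place_count \<beta> A x) + real (place_count \<beta> A (x - t))"
    using place_count_insert[of A "k * Suc j" \<beta> x] notin by (simp only: of_nat_add simp_thms)
  also have "\<dots> \<le> \<rho> ^ m * G (\<gamma> * y + 1) + \<rho> ^ m * G (\<gamma> * y - 1)"
    using IH[of x] IH[of "x - t"] unfolding e1 e2 by (rule add_mono)
  also have "\<dots> = \<rho> ^ m * (G (\<gamma> * y - 1) + G (\<gamma> * y + 1))" by (simp add: algebra_simps)
  also have "\<dots> \<le> \<rho> ^ m * (\<rho> * G y)"
    using assms(3) super[of y] unfolding \<gamma>_def by (intro mult_left_mono) auto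
  finally have le: "real (place_count \<beta> ((*) k ` {j+1..j+Suc m}) x) \<le> \<rho> ^ m * (\<rho> * G y)" .
  have "y = (\<beta> ^ k) ^ j * (2 * x - (\<Sum>i=j+1..j+Suc m. 1 / (\<beta> ^ k) ^ i))"
    unfolding range y_def s_def t_def \<gamma>_def by simp
  then show ?case using le unfolding power_Suc2 mult.assoc by (simp only:)
qed

section \<open>A supersolution for the digit walk\<close>

text \<open>
  Divide by the right-hand side \<open>S powr q\<close>, where \<open>q = r / (1 + r)\<close>, and write each term as a
  weighted geometric mean,
  \<open>(x / S) powr q = (x / A / S) powr q * (A powr r) powr (1 - q)\<close>. By Young's inequality the two terms
  add up to at most \<open>q * 1 + (1 - q) * (A powr r + B powr r)\<close>. The two
  steps are equalities when \<open>x / A / S = A powr r\<close> and \<open>y / B / S = B powr r\<close>, so the condition on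
  \<open>A\<close> and \<open>B\<close> is the best possible.
\<close>

lemma powr_add_le_weighted:
  fixes A B r x y :: real
  assumes "0 < A" "0 < B" "0 < r" "0 \<le> x" "0 \<le> y" and AB: "A powr r + B powr r \<le> 1"
  shows "x powr (r / (1 + r)) + y powr (r / (1 + r)) \<le> (x / A + y / B) powr (r / (1 + r))"
proof (cases "x = 0 \<and> y = 0")
  case False
  define q where "q = r / (1 + r)"
  define S where "S = x / A + y / B"
  have q: "0 < q" "q < 1" "1 - q = 1 / (1 + r)" using assms(3) by (auto simp: q_def field_simps)
  have S: "S > 0" using False assms unfolding S_def
    by (metis add_nonneg_pos add_pos_nonneg divide_nonneg_pos divide_pos_pos less_eq_real_def)
  have young: "(z / S) powr q \<le> q * (z / C / S) + (1 - q) * C powr r"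
    if "0 < C" "0 \<le> z" for z C
  proof (cases "z = 0")
    case False
    have "(C powr r) powr (1 - q) = C powr q"
    proof -
      have "r * (1 - q) = q" unfolding q(3) by (simp add: q_def)
      then show ?thesis by (simp add: powr_powr)
    qed
    moreover have "(z / S) powr q = ((z / C / S) * C) powr q" using that by simp
    moreover have "((z / C / S) * C) powr q = (z / C / S) powr q * C powr q"
      using that S by (simp only: powr_mult)
    ultimately have "(z / S) powr q = (z / C / S) powr q * (C powr r) powr (1 - q)" by simp
    also have "\<dots> \<le> q * (z / C / S) + (1 - q) * C powr r"
      using False that S q assms(3) by (intro Youngs_inequality_0) auto
    finally show ?thesis .
  qed (use q assms(3) in simp)
  have "(x / S) powr q + (y / S) powr q
      \<le> q * ((x / A + y / B) / S) + (1 - q) * (A powr r + B powr r)"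
    using young[OF assms(1,4)] young[OF assms(2,5)] by (simp add: algebra_simps add_divide_distrib)
  also have "\<dots> = q + (1 - q) * (A powr r + B powr r)" using S by (simp add: S_def)
  also have "\<dots> \<le> q + (1 - q) * 1" using AB q assms(3) by (intro add_left_mono mult_left_mono) auto
  finally have "(x powr q + y powr q) / S powr q \<le> 1"
    using assms S by (simp add: powr_divide add_divide_distrib)
  then show ?thesis using S unfolding q_def[symmetric] S_def[symmetric] by (simp add: divide_le_eq)
qed simp

text \<open>
  The argument of the power is the distance from \<open>y\<close> to the nearer end of the interval
  \<open>\<bar>y\<bar> \<le> 1 / (\<gamma> - 1)\<close>, scaled to be \<open>1\<close> in the centre. Since \<open>0 powr q = 0\<close> even for \<open>q = 0\<close>, the
  function vanishes outside the open interval in every case, and for \<open>q = 0\<close> it is the indicator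
  function of that interval.
\<close>

definition edge_power :: "real \<Rightarrow> real \<Rightarrow> real \<Rightarrow> real" where
  "edge_power \<gamma> q y = (max 0 (1 - (\<gamma> - 1) * \<bar>y\<bar>)) powr q"

text \<open>
  Let \<open>y \<ge> 0\<close> have distance \<open>v\<close>, and put \<open>s = \<gamma> * v\<close>. The point \<open>\<gamma> * y + 1\<close> has distance
  \<open>s - 2 * (\<gamma> - 1)\<close>, and the point \<open>\<gamma> * y - 1\<close> has distance \<open>min s (2 - s)\<close>. If the first of
  these is not positive, only the second point counts and the bound \<open>s\<close> suffices. Otherwise both
  points count, and the bound \<open>2 - s\<close> leads to the assumption \<open>branch\<close>.
\<close>

lemma edge_power_supersolution:
  assumes \<gamma>: "1 < \<gamma>" and q: "0 \<le> q"
    and branch: "\<And>s. 2 * (\<gamma> - 1) < s \<Longrightarrow> s \<le> \<gamma> \<Longrightarrow>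
      (2 - s) powr q + (s - 2 * (\<gamma> - 1)) powr q \<le> s powr q"
  shows "edge_power \<gamma> q (\<gamma> * y - 1) + edge_power \<gamma> q (\<gamma> * y + 1) \<le> \<gamma> powr q * edge_power \<gamma> q y"
proof -
  have even: "edge_power \<gamma> q (- y) = edge_power \<gamma> q y" for y
    by (simp add: edge_power_def)
  have pos: "edge_power \<gamma> q (\<gamma> * y - 1) + edge_power \<gamma> q (\<gamma> * y + 1) \<le> \<gamma> powr q * edge_power \<gamma> q y"
    if y: "0 \<le> y" for y
  proof -
    define v where "v = 1 - (\<gamma> - 1) * y"
    define s where "s = \<gamma> * v"
    have v1: "v \<le> 1" unfolding v_def using y \<gamma> by simp
    have s_le: "s \<le> \<gamma>" unfolding s_def using v1 \<gamma> by simp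
    have s_y: "s = \<gamma> - (\<gamma> - 1) * (\<gamma> * y)" unfolding s_def v_def by (simp add: algebra_simps)
    have centre: "edge_power \<gamma> q y = (max 0 v) powr q"
      unfolding edge_power_def v_def using y by simp
    have right: "edge_power \<gamma> q (\<gamma> * y + 1) = (max 0 (s - 2 * (\<gamma> - 1))) powr q"
      unfolding edge_power_def s_y using y \<gamma> by (simp add: algebra_simps)
    have left1: "1 - (\<gamma> - 1) * \<bar>\<gamma> * y - 1\<bar> \<le> s"
      and left2: "1 - (\<gamma> - 1) * \<bar>\<gamma> * y - 1\<bar> \<le> 2 - s"
    proof -
      have "(\<gamma> - 1) * (\<gamma> * y - 1) \<le> (\<gamma> - 1) * \<bar>\<gamma> * y - 1\<bar>"
        "(\<gamma> - 1) * (1 - \<gamma> * y) \<le> (\<gamma> - 1) * \<bar>\<gamma> * y - 1\<bar>"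
        using \<gamma> by (auto intro!: mult_left_mono)
      then show "1 - (\<gamma> - 1) * \<bar>\<gamma> * y - 1\<bar> \<le> s" "1 - (\<gamma> - 1) * \<bar>\<gamma> * y - 1\<bar> \<le> 2 - s"
        unfolding s_y by (simp_all add: algebra_simps)
    qed
    show ?thesis
    proof (cases "v \<le> 0")
      case True
      then have "s \<le> 0" unfolding s_def using \<gamma> by (simp add: mult_nonneg_nonpos)
      then show ?thesis using True \<gamma> left1 unfolding centre right by (simp add: edge_power_def max_def)
    next
      case False
      then have s0: "0 < s" unfolding s_def using \<gamma> by simp
      have target: "\<gamma> powr q * edge_power \<gamma> q y = s powr q"
        unfolding centre s_def using False \<gamma> by (simp add: powr_mult)
      show ?thesis
      proof (cases "s \<le> 2 * (\<gamma> - 1)")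
        case True
        have "edge_power \<gamma> q (\<gamma> * y - 1) \<le> s powr q"
          unfolding edge_power_def using left1 s0 q by (intro powr_mono2) auto
        then show ?thesis unfolding target right using True by simp
      next
        case b: False
        show ?thesis
        proof (cases "s \<le> 2")
          case True
          have "edge_power \<gamma> q (\<gamma> * y - 1) \<le> (2 - s) powr q"
            unfolding edge_power_def using left2 True q by (intro powr_mono2) auto
          then show ?thesis unfolding target right using branch[of s] b s_le by simp
        next
          case False
          then have "2 < s" "2 * (\<gamma> - 1) < s" using b by simp_all
          then have False using s_le by argo
          then show ?thesis ..
        qed
      qed
    qed
  qed
  show ?thesis
  proof (cases "0 \<le> y")
    case False
    have "\<gamma> * y - 1 = - (\<gamma> * (- y) + 1)" "\<gamma> * y + 1 = - (\<gamma> * (- y) - 1)" by simp_all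
    then show ?thesis using pos[of "- y"] False even by (metis add.commute le_minus_iff linear minus_zero neg_le_0_iff_le)
  qed (rule pos)
qed

section \<open>The exponent\<close>

text \<open>
  Both terms decrease in \<open>\<gamma>\<close>, so it suffices to look at the left end \<open>b\<close> of an interval. The number
  \<open>A\<close> separates the two terms there, which removes the roots from the condition.
\<close>

lemma powr_sum_le_1I:
  fixes \<gamma> b A :: real and m n :: nat
  assumes "\<gamma> < 2" "3 / 2 \<le> b" "b \<le> \<gamma>" "0 < m" "0 < n" "0 \<le> A" "A \<le> 1"
    and "(2 - b) ^ m \<le> A ^ n" "((2 - b) / (b - 1)) ^ m \<le> (1 - A) ^ n"
  shows "((2 - \<gamma>) / (\<gamma> - 1)) powr (m / n) + (2 - \<gamma>) powr (m / n) \<le> 1"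
proof -
  have root: "x powr (real m / real n) \<le> C" if "0 \<le> x" "x ^ m \<le> C ^ n" "0 \<le> C" for x C :: real
  proof -
    have "x powr (real m / real n) = (x ^ m) powr (1 / real n)"
      using that assms by (simp add: powr_realpow'[symmetric] powr_powr)
    also have "\<dots> \<le> (C ^ n) powr (1 / real n)" using that by (intro powr_mono2) auto
    also have "\<dots> = C" using that assms by (simp add: powr_realpow'[symmetric] powr_powr)
    finally show ?thesis .
  qed
  have "(2 - \<gamma>) ^ m \<le> (2 - b) ^ m" "((2 - \<gamma>) / (\<gamma> - 1)) ^ m \<le> ((2 - b) / (b - 1)) ^ m"
    using assms by (auto intro!: power_mono frac_le)
  then have "(2 - \<gamma>) ^ m \<le> A ^ n" "((2 - \<gamma>) / (\<gamma> - 1)) ^ m \<le> (1 - A) ^ n"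
    using assms by linarith+
  moreover have "0 \<le> (2 - \<gamma>) / (\<gamma> - 1)" using assms by simp
  ultimately have "(2 - \<gamma>) powr (real m / real n) \<le> A"
    "((2 - \<gamma>) / (\<gamma> - 1)) powr (real m / real n) \<le> 1 - A"
    using assms by (auto intro!: root)
  then show ?thesis by linarith
qed

text \<open>
  The rational number \<open>u / w\<close> is an upper bound for \<open>log 2 c\<close>. Going through it keeps the powers in the
  numerical hypothesis small.
\<close>

lemma powr_le_2I:
  fixes \<gamma> c :: real and m n u w :: nat
  assumes "1 \<le> \<gamma>" "\<gamma> \<le> c" "0 < n" "0 < w"
    and "c ^ w \<le> 2 ^ u" "u * (16 * m + 13 * (m + n)) \<le> w * (16 * (m + n))"
  shows "\<gamma> powr (real m / real (m + n)) \<le> 2 * \<gamma> powr (- 13 / 16)"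
proof -
  define e where "e = real m / real (m + n) + 13 / 16"
  have e: "0 \<le> e" unfolding e_def by simp
  have "\<gamma> ^ w \<le> 2 ^ u"
    using assms power_mono[of \<gamma> c w] by linarith
  then have "\<gamma> powr real w \<le> 2 powr real u"
    using assms(1) by (simp add: powr_realpow)
  then have "(\<gamma> powr real w) powr (1 / real w) \<le> (2 powr real u) powr (1 / real w)"
    by (intro powr_mono2) auto
  then have "\<gamma> \<le> 2 powr (real u / real w)"
    using assms(1,4) by (simp add: powr_powr)
  then have "\<gamma> powr e \<le> (2 powr (real u / real w)) powr e"
    using e assms(1) by (intro powr_mono2) auto
  also have "\<dots> = 2 powr (real u / real w * e)" by (rule powr_powr)
  also have "\<dots> \<le> 2 powr 1"
  proof (rule powr_mono)
    have "real (u * (16 * m + 13 * (m + n))) \<le> real (w * (16 * (m + n)))"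
      using assms(6) by (simp only: of_nat_le_iff)
    then have "real u * (16 * real m + 13 * real (m + n)) \<le> real w * (16 * real (m + n))"
      by (simp only: of_nat_mult of_nat_add of_nat_numeral)
    moreover have "e = (16 * real m + 13 * real (m + n)) / (16 * real (m + n))"
      unfolding e_def using assms(3) by (simp add: field_simps)
    ultimately show "real u / real w * e \<le> 1"
      using assms(3,4) by (simp only: times_divide_times_eq) (simp add: divide_le_eq)
  qed simp
  finally have "\<gamma> powr (real m / real (m + n)) * \<gamma> powr (13 / 16) \<le> 2"
    unfolding e_def by (simp only: powr_add powr_one)
  then show ?thesis using assms(1) by (simp add: powr_minus_divide pos_le_divide_eq)
qed

text \<open>
  For \<open>r = m / n\<close> the exponent is \<open>q = m / (m + n)\<close>. The first condition holds up to a certain \<open>\<gamma>\<close>, the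
  second one from a certain \<open>\<gamma>\<close> on, and for the eleven values of \<open>r\<close> below these ranges overlap.
  For \<open>r = 1\<close> the second condition starts exactly at the golden ratio.
\<close>

lemma exists_exponent:
  fixes \<gamma> :: real
  assumes "3063 / 2000 \<le> \<gamma>" "\<gamma> < 2"
  shows "\<exists>r>0. \<gamma> powr (r / (1 + r)) \<le> 2 * \<gamma> powr (- 13 / 16) \<and>
    ((2 - \<gamma>) / (\<gamma> - 1)) powr r + (2 - \<gamma>) powr r \<le> 1"
proof -
  have step: ?thesis
    if "b \<le> \<gamma>" "\<gamma> \<le> c" "3 / 2 \<le> b" "0 < m" "0 < n" "0 \<le> A" "A \<le> 1"
      "0 < w" "c ^ w \<le> 2 ^ u" "u * (16 * m + 13 * (m + n)) \<le> w * (16 * (m + n))"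
      "(2 - b) ^ m \<le> A ^ n" "((2 - b) / (b - 1)) ^ m \<le> (1 - A) ^ n"
    for b c A :: real and m n u w :: nat
  proof (intro exI conjI)
    show "0 < real m / real n" using that by simp
    have "real m / real n / (1 + real m / real n) = real m / real (m + n)"
      using that by (simp add: field_simps)
    then show "\<gamma> powr (real m / real n / (1 + real m / real n)) \<le> 2 * \<gamma> powr (- 13 / 16)"
      using powr_le_2I[of \<gamma> c n w u m] that assms by simp
    show "((2 - \<gamma>) / (\<gamma> - 1)) powr (real m / real n) + (2 - \<gamma>) powr (real m / real n) \<le> 1"
      using that assms by (intro powr_sum_le_1I[of \<gamma> b m n A]) auto
  qed
  \<comment> \<open>The arguments of \<open>step\<close> are the ends of the interval, then \<open>r = m / n\<close>, the separating
    number \<open>A\<close>, and \<open>w\<close>, \<open>u\<close> with \<open>log 2 c \<le> u / w\<close>.\<close>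
  consider "\<gamma> \<le> 11/7"
    | "11/7 \<le> \<gamma>" "\<gamma> \<le> 13/8"
    | "13/8 \<le> \<gamma>" "\<gamma> \<le> 22/13"
    | "22/13 \<le> \<gamma>" "\<gamma> \<le> 26/15"
    | "26/15 \<le> \<gamma>" "\<gamma> \<le> 25/14"
    | "25/14 \<le> \<gamma>" "\<gamma> \<le> 31/17"
    | "31/17 \<le> \<gamma>" "\<gamma> \<le> 13/7"
    | "13/7 \<le> \<gamma>" "\<gamma> \<le> 17/9"
    | "17/9 \<le> \<gamma>" "\<gamma> \<le> 23/12"
    | "23/12 \<le> \<gamma>" "\<gamma> \<le> 41/21"
    | "41/21 \<le> \<gamma>"
    by linarith
  then show ?thesis
  proof cases
    case 1 then show ?thesis using assms by (intro step[of "3063/2000" "11/7" 2 1 "2/9" 3 2]) (simp_all add: power_divide)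
  next
    case 2 then show ?thesis by (intro step[of "11/7" "13/8" 3 2 "1/3" 17 12]) (simp_all add: power_divide)
  next
    case 3 then show ?thesis by (intro step[of "13/8" "22/13" 1 1 "2/5" 21 16]) (simp_all add: power_divide)
  next
    case 4 then show ?thesis by (intro step[of "22/13" "26/15" 3 4 "3/7" 5 4]) (simp_all add: power_divide)
  next
    case 5 then show ?thesis by (intro step[of "26/15" "25/14" 3 5 "5/11" 19 16]) (simp_all add: power_divide)
  next
    case 6 then show ?thesis by (intro step[of "25/14" "31/17" 1 2 "7/15" 23 20]) (simp_all add: power_divide)
  next
    case 7 then show ?thesis by (intro step[of "31/17" "13/7" 3 7 "10/21" 19 17]) (simp_all add: power_divide)
  next
    case 8 then show ?thesis by (intro step[of "13/7" "17/9" 3 8 "14/29" 25 23]) (simp_all add: power_divide)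
  next
    case 9 then show ?thesis by (intro step[of "17/9" "23/12" 1 3 "1/2" 17 16]) (simp_all add: power_divide)
  next
    case 10 then show ?thesis by (intro step[of "23/12" "41/21" 2 7 "30/61" 29 28]) (simp_all add: power_divide)
  next
    case 11 then show ?thesis using assms by (intro step[of "41/21" "2" 3 13 "53/107" 1 1]) (simp_all add: power_divide)
  qed
qed

text \<open>
  For \<open>\<gamma> < 2\<close> the two branches have distances \<open>2 - s\<close> and \<open>s - 2 * (\<gamma> - 1)\<close>, and the weights
  \<open>(\<gamma> - 1) / (2 - \<gamma>)\<close> and \<open>1 / (2 - \<gamma>)\<close> combine them to \<open>s\<close> for every \<open>s\<close>. For \<open>\<gamma> \<ge> 2\<close> the two
  branches never survive together, and the indicator function works, as \<open>2 * \<gamma> powr (- 13 / 16) \<ge> 1\<close>.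
\<close>

lemma exists_supersolution:
  fixes \<gamma> :: real
  assumes "3063 / 2000 \<le> \<gamma>" "\<gamma> < (3063 / 2000)\<^sup>2"
  obtains G where "G 0 = 1" "\<And>y. 0 \<le> G y" "\<And>y. G y \<le> 1"
    "\<And>y. G (\<gamma> * y - 1) + G (\<gamma> * y + 1) \<le> 2 * \<gamma> powr (- 13 / 16) * G y"
proof -
  have "\<exists>q\<ge>0. \<gamma> powr q \<le> 2 * \<gamma> powr (- 13 / 16) \<and>
    (\<forall>s. 2 * (\<gamma> - 1) < s \<longrightarrow> s \<le> \<gamma> \<longrightarrow> (2 - s) powr q + (s - 2 * (\<gamma> - 1)) powr q \<le> s powr q)"
  proof (cases "\<gamma> < 2")
    case True
    then obtain r where r: "r > 0" "\<gamma> powr (r / (1 + r)) \<le> 2 * \<gamma> powr (- 13 / 16)"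
      and le1: "((2 - \<gamma>) / (\<gamma> - 1)) powr r + (2 - \<gamma>) powr r \<le> 1"
      using exists_exponent assms by blast
    have "(2 - s) powr (r / (1 + r)) + (s - 2 * (\<gamma> - 1)) powr (r / (1 + r)) \<le> s powr (r / (1 + r))"
      if s: "2 * (\<gamma> - 1) < s" "s \<le> \<gamma>" for s
    proof -
      have "(2 - s) / ((2 - \<gamma>) / (\<gamma> - 1)) + (s - 2 * (\<gamma> - 1)) / (2 - \<gamma>)
          = ((2 - s) * (\<gamma> - 1) + (s - 2 * (\<gamma> - 1))) / (2 - \<gamma>)"
        by (simp add: add_divide_distrib)
      also have "(2 - s) * (\<gamma> - 1) + (s - 2 * (\<gamma> - 1)) = s * (2 - \<gamma>)" by (simp add: algebra_simps)
      finally have "(2 - s) / ((2 - \<gamma>) / (\<gamma> - 1)) + (s - 2 * (\<gamma> - 1)) / (2 - \<gamma>) = s"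
        using True by simp
      then show ?thesis
        using powr_add_le_weighted[OF _ _ r(1) _ _ le1, of "2 - s" "s - 2 * (\<gamma> - 1)"] s assms True
        by simp
    qed
    then show ?thesis using r by (intro exI[of _ "r / (1 + r)"]) auto
  next
    case False
    have "\<gamma> powr (real 0 / real (0 + 1)) \<le> 2 * \<gamma> powr (- 13 / 16)"
      \<comment> \<open>\<open>m = 0\<close>, \<open>n = 1\<close> stand for \<open>q = 0\<close>; the claim is then \<open>\<gamma> ^ 13 \<le> 2 ^ 16\<close>.\<close>
      using False assms by (intro powr_le_2I[of \<gamma> "(3063 / 2000)\<^sup>2" 1 13 16]) (simp_all add: power_divide)
    then show ?thesis using False by (intro exI[of _ 0]) auto
  qed
  then obtain q where q: "q \<ge> 0" "\<gamma> powr q \<le> 2 * \<gamma> powr (- 13 / 16)"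
    and br: "\<And>s. 2 * (\<gamma> - 1) < s \<Longrightarrow> s \<le> \<gamma> \<Longrightarrow> (2 - s) powr q + (s - 2 * (\<gamma> - 1)) powr q \<le> s powr q"
    by blast
  show ?thesis
  proof (rule that[of "edge_power \<gamma> q"])
    fix y
    show "edge_power \<gamma> q y \<le> 1"
      unfolding edge_power_def using q(1) assms by (intro powr_le1) auto
    have "edge_power \<gamma> q (\<gamma> * y - 1) + edge_power \<gamma> q (\<gamma> * y + 1) \<le> \<gamma> powr q * edge_power \<gamma> q y"
      using br q(1) assms by (intro edge_power_supersolution) auto
    also have "\<dots> \<le> 2 * \<gamma> powr (- 13 / 16) * edge_power \<gamma> q y"
      using q(2) by (intro mult_right_mono) (simp_all add: edge_power_def)
    finally show "edge_power \<gamma> q (\<gamma> * y - 1) + edge_power \<gamma> q (\<gamma> * y + 1)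
      \<le> 2 * \<gamma> powr (- 13 / 16) * edge_power \<gamma> q y" .
  qed (auto simp: edge_power_def)
qed

section \<open>The entropy bound\<close>

text \<open>
  The first power that reaches \<open>b\<close> exceeds a power below \<open>b\<close> by a factor \<open>\<beta>\<close>, and \<open>\<beta> < b\<close> unless
  that power is \<open>\<beta>\<close> itself.
\<close>

lemma exists_power_between:
  fixes b \<beta> :: real
  assumes "1 < b" "1 < \<beta>" "\<beta> < b\<^sup>2"
  obtains k :: nat where "0 < k" "b \<le> \<beta> ^ k" "\<beta> ^ k < b\<^sup>2"
proof -
  define k where "k = (LEAST k. b \<le> \<beta> ^ k)"
  have "\<exists>k. b \<le> \<beta> ^ k" using real_arch_pow[OF assms(2)] less_imp_le by blast
  then have k: "b \<le> \<beta> ^ k" unfolding k_def by (rule LeastI_ex)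
  then have k0: "k \<noteq> 0" using assms by (auto intro: ccontr)
  then obtain l where l: "k = Suc l" by (cases k) auto
  have small: "\<beta> ^ l < b" using not_less_Least[of l "\<lambda>k. b \<le> \<beta> ^ k"] l unfolding k_def by auto
  have "\<beta> ^ k < b\<^sup>2"
  proof (cases "l = 0")
    case False
    then have "\<beta> \<le> \<beta> ^ l" using assms by (simp add: self_le_power)
    then have "\<beta> * \<beta> ^ l < b * b" using small assms by (intro mult_strict_mono') auto
    then show ?thesis by (simp add: l power2_eq_square)
  qed (use assms l in simp)
  then show ?thesis using that k k0 by blast
qed

lemma digit_count_le_of_power:
  assumes "1 < \<beta>" "0 < k" and "3063 / 2000 \<le> \<beta> ^ k" "\<beta> ^ k < (3063 / 2000)\<^sup>2"
  shows "real (digit_count \<beta> n x) / 2 ^ n \<le> ((\<beta> ^ k) powr (- 13 / 16)) ^ (n div k)"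
proof -
  define \<rho> where "\<rho> = 2 * (\<beta> ^ k) powr (- 13 / 16)"
  define m where "m = n div k"
  define A where "A = (*) k ` {0+1..0+m}"
  obtain G where G: "G 0 = 1" "\<And>y. 0 \<le> G y" "\<And>y. G y \<le> 1"
    "\<And>y. G (\<beta> ^ k * y - 1) + G (\<beta> ^ k * y + 1) \<le> \<rho> * G y"
    unfolding \<rho>_def using exists_supersolution[OF assms(3,4)] by blast
  have \<rho>: "0 \<le> \<rho>" unfolding \<rho>_def by simp
  have A: "real (place_count \<beta> A x) \<le> \<rho> ^ m" for x
  proof -
    have "real (place_count \<beta> A x)
        \<le> \<rho> ^ m * G ((\<beta> ^ k) ^ 0 * (2 * x - (\<Sum>i=0+1..0+m. 1 / (\<beta> ^ k) ^ i)))"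
      unfolding A_def using G \<rho> assms by (intro place_count_le_supersolution) auto
    also have "\<dots> \<le> \<rho> ^ m * 1" using G(3) \<rho> by (intro mult_left_mono) auto
    finally show ?thesis by simp
  qed
  have "k * m \<le> n" unfolding m_def by simp
  have sub: "A \<subseteq> {1..n}"
  proof
    fix i assume "i \<in> A"
    then obtain l where "i = k * l" "l \<in> {0+1..0+m}" unfolding A_def by (rule imageE)
    then have l: "i = k * l" "1 \<le> l" "l \<le> m" by simp_all
    have "k * l \<le> n" using mult_le_mono2[OF l(3)] \<open>k * m \<le> n\<close> by (rule order_trans)
    then show "i \<in> {1..n}" using l assms(2) by simp
  qed
  have cardA: "card A = m" unfolding A_def using assms(2) by (subst card_image) (auto simp: inj_on_def)
  then have "m \<le> n" using sub card_mono[of "{1..n}" A] by simp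
  have "real (digit_count \<beta> n x) = real (place_count \<beta> (A \<union> ({1..n} - A)) x)"
    using sub by (simp add: digit_count_eq_place_count Un_absorb1)
  also have "\<dots> \<le> 2 ^ card ({1..n} - A) * \<rho> ^ m"
    by (rule place_count_Un_le) (use A sub in \<open>auto simp: A_def\<close>)
  also have "\<dots> = 2 ^ (n - m) * \<rho> ^ m" using sub cardA by (simp add: card_Diff_subset A_def)
  also have "\<dots> = 2 ^ n * ((\<beta> ^ k) powr (- 13 / 16)) ^ m"
    using \<open>m \<le> n\<close> by (simp add: \<rho>_def power_mult_distrib flip: power_add)
  finally show ?thesis unfolding m_def by (simp add: divide_le_eq mult.commute)
qed

theorem theorem9:
  fixes \<beta> :: real
  assumes "pisot_number \<beta>" and "1 < \<beta>" and "\<beta> < 2"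
  shows "garsia_entropy \<beta> > 0.81"
proof -
  obtain k where k: "0 < k" "3063 / 2000 \<le> \<beta> ^ k" "\<beta> ^ k < (3063 / 2000)\<^sup>2"
    using exists_power_between[of "3063 / 2000" \<beta>] assms(2,3) by (auto simp: power2_eq_square)
  have lb: "0 < ln \<beta>" using assms by simp
  have level: "13 / 16 * ln \<beta> * (real n - real k) \<le> H_level \<beta> n" for n
  proof (rule H_level_ge[OF assms(2)])
    fix x
    have "n < k * (n div k) + k" using k(1) by (metis add.commute add_less_cancel_right mod_less_divisor mult_div_mod_eq nat_add_left_cancel_less)
    then have "real n - real k \<le> real k * real (n div k)"
      by (metis le_diff_eq less_imp_le of_nat_add of_nat_le_iff of_nat_mult diff_le_eq)
    then have "13 / 16 * ln \<beta> * (real n - real k) \<le> 13 / 16 * ln \<beta> * (real k * real (n div k))"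
      using lb by (intro mult_left_mono) auto
    moreover have "((\<beta> ^ k) powr (- 13 / 16)) ^ (n div k) = exp (- (13 / 16 * ln \<beta> * (real k * real (n div k))))"
      using assms by (simp add: powr_def ln_realpow exp_of_nat_mult[symmetric] algebra_simps)
    ultimately show "real (digit_count \<beta> n x) / 2 ^ n \<le> exp (- (13 / 16 * ln \<beta> * (real n - real k)))"
      using digit_count_le_of_power[OF assms(2) k, of n x] by (smt (verit) exp_le_cancel_iff)
  qed
  have "(\<lambda>n. H_level \<beta> n / (real n * ln \<beta>)) \<longlonglongrightarrow> garsia_entropy \<beta>"
    unfolding garsia_entropy_def using H_level_rate_convergent[OF assms(2)]
    by (simp add: convergent_LIMSEQ_iff)
  moreover have "(\<lambda>n. 13 / 16 * (1 - real k / real n)) \<longlonglongrightarrow> 13 / 16 * (1 - 0)"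
    by (intro tendsto_intros lim_const_over_n)
  moreover have "\<forall>\<^sub>F n in sequentially. 13 / 16 * (1 - real k / real n) \<le> H_level \<beta> n / (real n * ln \<beta>)"
  proof (rule eventually_sequentiallyI[of 1])
    fix n :: nat assume "1 \<le> n"
    then have "13 / 16 * (1 - real k / real n) = 13 / 16 * ln \<beta> * (real n - real k) / (real n * ln \<beta>)"
      using lb by (simp add: field_simps)
    also have "\<dots> \<le> H_level \<beta> n / (real n * ln \<beta>)"
      using level[of n] lb by (intro divide_right_mono) auto
    finally show "13 / 16 * (1 - real k / real n) \<le> H_level \<beta> n / (real n * ln \<beta>)" .
  qed
  ultimately have "13 / 16 * (1 - 0) \<le> garsia_entropy \<beta>"
    by (intro tendsto_le[OF trivial_limit_sequentially])
  then show ?thesis by simp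
qed

end
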